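(* Let $p$ be a positive integer and let $\Lambda_1,\dots,\Lambda_{p-1}\ge 0$. Let $$F(z)=\sum_{k=0}^{p-1}\bar z^{k}A_k(z)$$ be a poly-analytic function of order $p$ in $U$, where all $A_k$ are analytic in $U$ and satisfy $A_k(0)=0$ for $k\in\{0,\dots,p-1\}$, $A_0'(0)=1$, $|A_k'(z)|\le\Lambda_k$ for all $z\in U$ and $k\in\{1,\dots,p-1\}$, and either $|A_0(z)|<1$ for all $z\in U$ or $|A_0'(z)|\le 1$ for all $z\in U$. Then $F$ is univalent in $U_{\rho_2}$ and $F(U_{\rho_2})$ contains the schlicht disk $U_{\sigma_2}$, where $$\rho_2=\begin{cases}1,&\text{if }\sum_{k=1}^{p-1}(k+1)\Lambda_k\le 1,\\ \rho_2',&\text{if }\sum_{k=1}^{p-1}(k+1)\Lambda_k>1,\end{cases}$$ $\rho_2'$ is the unique root in $(0,1)$ of the equation $$1-\sum_{k=1}^{p-1}(k+1)\Lambda_kr^k=0,$$ and $$\sigma_2=\rho_2-\sum_{k=1}^{p-1}\Lambda_k\rho_2^{k+1}.$$ This result is sharp, with an extremal function given by $$F_2(z)=z-\sum_{k=1}^{p-1}\Lambda_k\bar z^kz;$$ that is, $F_2$ satisfies all the hypotheses above, $F_2$ is not univalent in $U_r$ for any $r\in(\rho_2,1]$, and $F_2(U_{\rho_2})$ contains no disk $U_R$ with $R>\sigma_2$.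
   Context: For $r>0$, $U_r=\{z\in\mathbb C:|z|<r\}$ and $U=U_1$. A continuous function $F:D\to\mathbb C$ on a domain $D\subset\mathbb C$ is poly-analytic of order $p$ if $\partial^pF/\partial\bar z^p=0$ in $D$; in a simply connected domain this is equivalent to $F=\sum_{k=0}^{p-1}\bar z^kA_k(z)$ with all $A_k$ analytic. Univalent means injective. A schlicht disk in $F(U_\rho)$ is a disk that is the univalent image under $F$ of some region in $U_\rho$. Empty sums (when $p=1$) are $0$; the interval $(1,1]$ is empty. *)

theory Defs
  imports "HOL-Complex_Analysis.Complex_Analysis"
begin

text \<open>
  The Wirtinger derivative \<open>(1/2) (\<partial>F/\<partial>x + \<i> \<partial>F/\<partial>y)\<close>; the real partial derivatives are the
  values of the real Frechet derivative at \<open>1\<close> and \<open>\<i>\<close>. It is meaningful only where \<open>F\<close> is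
  real differentiable.
\<close>

definition deriv_cnj :: "(complex \<Rightarrow> complex) \<Rightarrow> complex \<Rightarrow> complex" where
  "deriv_cnj F z =
     (frechet_derivative F (at z) 1 + \<i> * frechet_derivative F (at z) \<i>) / 2"

text \<open>
  The differentiability clause makes all iterated derivatives up to order \<open>p\<close> genuine ones
  (\<open>differentiable\<close> is real differentiability here). As \<open>D\<close> is open, the values of \<open>F\<close> outside
  \<open>D\<close> play no role.
\<close>

definition polyanalytic_on :: "nat \<Rightarrow> (complex \<Rightarrow> complex) \<Rightarrow> complex set \<Rightarrow> bool" where
  "polyanalytic_on p F D \<longleftrightarrow>
     open D \<and> connected D \<and> D \<noteq> {} \<and> continuous_on D F \<and>
     (\<forall>j<p. \<forall>z\<in>D. (deriv_cnj ^^ j) F differentiable (at z)) \<and>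
     (\<forall>z\<in>D. (deriv_cnj ^^ p) F z = 0)"

definition schlicht_disk_in :: "(complex \<Rightarrow> complex) \<Rightarrow> real \<Rightarrow> complex set \<Rightarrow> bool" where
  "schlicht_disk_in F \<rho> B \<longleftrightarrow>
     (\<exists>c R. 0 < R \<and> B = ball c R) \<and>
     (\<exists>D. open D \<and> connected D \<and> D \<noteq> {} \<and> D \<subseteq> ball 0 \<rho> \<and> inj_on F D \<and> F ` D = B)"

definition admissible ::
  "nat \<Rightarrow> (nat \<Rightarrow> real) \<Rightarrow> (nat \<Rightarrow> complex \<Rightarrow> complex) \<Rightarrow> (complex \<Rightarrow> complex) \<Rightarrow> bool" where
  "admissible p \<Lambda> A F \<longleftrightarrow>
     polyanalytic_on p F (ball 0 1) \<and>
     (\<forall>z\<in>ball 0 1. F z = (\<Sum>k=0..p-1. cnj z ^ k * A k z)) \<and>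
     (\<forall>k\<in>{0..p-1}. A k analytic_on ball 0 1 \<and> A k 0 = 0) \<and>
     deriv (A 0) 0 = 1 \<and>
     (\<forall>k\<in>{1..p-1}. \<forall>z\<in>ball 0 1. cmod (deriv (A k) z) \<le> \<Lambda> k) \<and>
     ((\<forall>z\<in>ball 0 1. cmod (A 0 z) < 1) \<or> (\<forall>z\<in>ball 0 1. cmod (deriv (A 0) z) \<le> 1))"

definition is_radius_root :: "nat \<Rightarrow> (nat \<Rightarrow> real) \<Rightarrow> real \<Rightarrow> bool" where
  "is_radius_root p \<Lambda> r \<longleftrightarrow>
     0 < r \<and> r < 1 \<and> 1 - (\<Sum>k=1..p-1. (real k + 1) * \<Lambda> k * r ^ k) = 0"

definition rho2 :: "nat \<Rightarrow> (nat \<Rightarrow> real) \<Rightarrow> real" where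
  "rho2 p \<Lambda> =
     (if (\<Sum>k=1..p-1. (real k + 1) * \<Lambda> k) \<le> 1 then 1 else (THE r. is_radius_root p \<Lambda> r))"

definition sigma2 :: "nat \<Rightarrow> (nat \<Rightarrow> real) \<Rightarrow> real" where
  "sigma2 p \<Lambda> = rho2 p \<Lambda> - (\<Sum>k=1..p-1. \<Lambda> k * rho2 p \<Lambda> ^ (k + 1))"

definition F2 :: "nat \<Rightarrow> (nat \<Rightarrow> real) \<Rightarrow> complex \<Rightarrow> complex" where
  "F2 p \<Lambda> z = z - (\<Sum>k=1..p-1. of_real (\<Lambda> k) * cnj z ^ k * z)"

end

theory Submission
  imports Defs
begin

text \<open>
  Schwarz's lemma forces \<open>A\<^sub>0 = id\<close>, since the condition \<open>|A\<^sub>0'| \<le> 1\<close> also implies \<open>|A\<^sub>0(z)| < 1\<close>.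
  So \<open>F = id + G\<close>, and on \<open>|z| \<le> r\<close> the perturbation \<open>G\<close> is Lipschitz with constant
  \<open>q(r) = \<Sum> (k + 1) \<Lambda>\<^sub>k r\<^sup>k\<close>. As \<open>q(r) < 1\<close> for \<open>r < \<rho>\<^sub>2\<close>, this gives injectivity, and
  Banach's fixed point theorem for \<open>z \<mapsto> w - G(z)\<close> gives the covering. On the real axis \<open>F\<^sub>2\<close> has
  derivative \<open>1 - q(x)\<close>, which changes sign at \<open>\<rho>\<^sub>2\<close> if \<open>\<rho>\<^sub>2 < 1\<close>, so injectivity fails beyond
  \<open>\<rho>\<^sub>2\<close>. Finally the value \<open>\<sigma>\<^sub>2 = F\<^sub>2(\<rho>\<^sub>2)\<close> is not attained for \<open>|z| < \<rho>\<^sub>2\<close>, because \<open>F\<^sub>2\<close>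
  remains injective when the boundary point \<open>\<rho>\<^sub>2\<close> is added: \<open>G\<close> is non-expanding on the
  closed disk and strictly contracting on the half of the segment from \<open>z\<close> to \<open>\<rho>\<^sub>2\<close> next to \<open>z\<close>.
\<close>

definition lip_const :: "nat \<Rightarrow> (nat \<Rightarrow> real) \<Rightarrow> real \<Rightarrow> real" where
  "lip_const p \<Lambda> r = (\<Sum>k=1..p-1. (real k + 1) * \<Lambda> k * r ^ k)"

text \<open>This is \<open>F2\<close> on the real axis. Its derivative at \<open>r\<close> is
  \<open>1 - lip_const p \<Lambda> r\<close>.\<close>

definition radial :: "nat \<Rightarrow> (nat \<Rightarrow> real) \<Rightarrow> real \<Rightarrow> real" where
  "radial p \<Lambda> r = r - (\<Sum>k=1..p-1. \<Lambda> k * r ^ (k + 1))"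

definition perturb :: "nat \<Rightarrow> (nat \<Rightarrow> complex \<Rightarrow> complex) \<Rightarrow> complex \<Rightarrow> complex" where
  "perturb p A z = (\<Sum>k=1..p-1. cnj z ^ k * A k z)"

section \<open>The radius of univalence\<close>

text \<open>As \<open>k \<ge> 1\<close>, every term of \<open>lip_const p \<Lambda> r / r\<close> is
  nondecreasing in \<open>r\<close>; cross-multiplying admits \<open>r = 0\<close>.\<close>

lemma lip_const_scale:
  assumes "\<And>k. k \<in> {1..p-1} \<Longrightarrow> 0 \<le> \<Lambda> k" and "0 \<le> r" and "r \<le> s"
  shows "s * lip_const p \<Lambda> r \<le> r * lip_const p \<Lambda> s"
proof -
  have "s * ((real k + 1) * \<Lambda> k * r ^ k) \<le> r * ((real k + 1) * \<Lambda> k * s ^ k)"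
    if k: "k \<in> {1..p-1}" for k
  proof -
    obtain m where m: "k = Suc m"
      using k by (cases k) auto
    have "r * s * r ^ m \<le> r * s * s ^ m"
      using assms(2,3) by (intro mult_left_mono power_mono) auto
    then have "s * r ^ k \<le> r * s ^ k"
      by (simp add: m algebra_simps)
    then have "((real k + 1) * \<Lambda> k) * (s * r ^ k) \<le> ((real k + 1) * \<Lambda> k) * (r * s ^ k)"
      using assms(1)[OF k] by (intro mult_left_mono) auto
    then show ?thesis
      by (simp add: algebra_simps)
  qed
  then show ?thesis
    unfolding lip_const_def sum_distrib_left by (intro sum_mono)
qed

text \<open>Scaling gives the bound \<open>r / s < 1\<close>. Strict monotonicity of
  \<open>lip_const\<close> would not serve here, as it fails when all \<Lambda> vanish.\<close>

lemma lip_const_less: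
  assumes "\<And>k. k \<in> {1..p-1} \<Longrightarrow> 0 \<le> \<Lambda> k"
    and "0 \<le> r" and "r < s" and "lip_const p \<Lambda> s \<le> 1"
  shows "lip_const p \<Lambda> r < 1"
proof -
  have "s * lip_const p \<Lambda> r \<le> r * lip_const p \<Lambda> s"
    using assms by (intro lip_const_scale) auto
  also have "\<dots> \<le> r * 1"
    using assms by (intro mult_left_mono) auto
  also have "\<dots> < s * 1"
    using assms by simp
  finally show ?thesis
    using assms by (simp add: mult_less_cancel_left)
qed

lemma lip_const_one: "lip_const p \<Lambda> 1 = (\<Sum>k=1..p-1. (real k + 1) * \<Lambda> k)"
  by (simp add: lip_const_def)

lemma lip_const_nonneg:
  assumes "\<And>k. k \<in> {1..p-1} \<Longrightarrow> 0 \<le> \<Lambda> k" and "0 \<le> r"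
  shows "0 \<le> lip_const p \<Lambda> r"
  unfolding lip_const_def using assms by (intro sum_nonneg) auto

lemma is_radius_root_iff: "is_radius_root p \<Lambda> r \<longleftrightarrow> 0 < r \<and> r < 1 \<and> lip_const p \<Lambda> r = 1"
  by (auto simp: is_radius_root_def lip_const_def)

text \<open>Existence is the intermediate value theorem on \<open>{0..1}\<close>; of two distinct
  roots, the smaller would have \<open>lip_const\<close> below 1 by
  \<open>lip_const_less\<close>.\<close>

lemma ex1_radius_root:
  assumes nn: "\<And>k. k \<in> {1..p-1} \<Longrightarrow> 0 \<le> \<Lambda> k" and gt: "1 < lip_const p \<Lambda> 1"
  shows "\<exists>!r. is_radius_root p \<Lambda> r"
proof (rule ex_ex1I)
  have "lip_const p \<Lambda> 0 = 0"
    by (simp add: lip_const_def)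
  moreover have "continuous_on {0..1} (lip_const p \<Lambda>)"
    unfolding lip_const_def by (intro continuous_intros)
  ultimately obtain r where r: "0 \<le> r" "r \<le> 1" "lip_const p \<Lambda> r = 1"
    using IVT'[of "lip_const p \<Lambda>" 0 1 1] gt by auto
  then have "is_radius_root p \<Lambda> r"
    unfolding is_radius_root_iff using gt \<open>lip_const p \<Lambda> 0 = 0\<close>
    by (cases "r = 0"; cases "r = 1") auto
  then show "\<exists>r. is_radius_root p \<Lambda> r" ..
next
  fix r s assume "is_radius_root p \<Lambda> r" "is_radius_root p \<Lambda> s"
  then show "r = s"
    using lip_const_less[of p \<Lambda> r s, OF nn] lip_const_less[of p \<Lambda> s r, OF nn]
    by (cases r s rule: linorder_cases) (auto simp: is_radius_root_iff)
qed

lemma rho2_cases: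
  assumes "\<And>k. k \<in> {1..p-1} \<Longrightarrow> 0 \<le> \<Lambda> k"
  obtains "rho2 p \<Lambda> = 1" and "lip_const p \<Lambda> 1 \<le> 1"
  | "0 < rho2 p \<Lambda>" and "rho2 p \<Lambda> < 1" and "lip_const p \<Lambda> (rho2 p \<Lambda>) = 1"
proof (cases "lip_const p \<Lambda> 1 \<le> 1")
  case True
  then show ?thesis
    using that(1) by (simp add: rho2_def lip_const_one)
next
  case False
  then have "is_radius_root p \<Lambda> (rho2 p \<Lambda>)"
    using theI'[OF ex1_radius_root[of p \<Lambda>]] assms by (simp add: rho2_def lip_const_one)
  then show ?thesis
    using that(2) by (simp add: is_radius_root_iff)
qed

lemma rho2_bounds:
  assumes "\<And>k. k \<in> {1..p-1} \<Longrightarrow> 0 \<le> \<Lambda> k"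
  shows "0 < rho2 p \<Lambda>" and "rho2 p \<Lambda> \<le> 1" and "lip_const p \<Lambda> (rho2 p \<Lambda>) \<le> 1"
  by (rule rho2_cases[of p \<Lambda>, OF assms]; simp)+

lemma sigma2_eq: "sigma2 p \<Lambda> = radial p \<Lambda> (rho2 p \<Lambda>)"
  by (simp add: sigma2_def radial_def)

text \<open>Since \<open>k + 1 \<ge> 2\<close>, the sum of
  \<open>\<Lambda> k * rho2 p \<Lambda> ^ k\<close> is at most 1/2, so \<open>sigma2\<close> is even
  at least half of \<open>rho2\<close>.\<close>

lemma sigma2_pos:
  assumes nn: "\<And>k. k \<in> {1..p-1} \<Longrightarrow> 0 \<le> \<Lambda> k"
  shows "0 < sigma2 p \<Lambda>"
proof -
  note \<rho> = rho2_bounds[of p \<Lambda>, OF nn]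
  have "2 * (\<Sum>k=1..p-1. \<Lambda> k * rho2 p \<Lambda> ^ k) \<le> lip_const p \<Lambda> (rho2 p \<Lambda>)"
    unfolding lip_const_def sum_distrib_left
  proof (intro sum_mono)
    fix k assume k: "k \<in> {1..p-1}"
    have "2 * (\<Lambda> k * rho2 p \<Lambda> ^ k) \<le> (real k + 1) * (\<Lambda> k * rho2 p \<Lambda> ^ k)"
      using k nn[OF k] \<rho>(1) by (intro mult_right_mono) auto
    then show "2 * (\<Lambda> k * rho2 p \<Lambda> ^ k) \<le> (real k + 1) * \<Lambda> k * rho2 p \<Lambda> ^ k"
      by (simp add: mult.assoc)
  qed
  then have "0 < rho2 p \<Lambda> * (1 - (\<Sum>k=1..p-1. \<Lambda> k * rho2 p \<Lambda> ^ k))"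
    using \<rho> by simp
  then show ?thesis
    by (simp add: sigma2_def sum_distrib_left algebra_simps)
qed

section \<open>Concavity of the real profile \<open>radial\<close>\<close>

lemma power_Suc_ge_tangent:
  fixes x y :: real
  assumes "0 \<le> y" and "y \<le> x"
  shows "y ^ (k + 1) + (real k + 1) * y ^ k * (x - y) \<le> x ^ (k + 1)"
proof (induction k)
  case 0
  then show ?case by simp
next
  case (Suc k)
  \<comment> \<open>This is exactly the gap between \<open>x\<close> times the tangent for exponent
    \<open>k + 1\<close> and the tangent for exponent \<open>k + 2\<close>.\<close>
  have "0 \<le> (real k + 1) * y ^ k * (x - y) * (x - y)"
    using assms by (intro mult_nonneg_nonneg) auto
  then have "y ^ (Suc k + 1) + (real (Suc k) + 1) * y ^ Suc k * (x - y)
      \<le> x * (y ^ (k + 1) + (real k + 1) * y ^ k * (x - y))"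
    by (simp add: algebra_simps)
  also have "\<dots> \<le> x * x ^ (k + 1)"
    using Suc assms by (intro mult_left_mono) auto
  finally show ?case by simp
qed

text \<open>Needed at \<open>y = rho2 p \<Lambda>\<close>: when the tangent there is horizontal,
  \<open>radial\<close> cannot rise any further.\<close>

lemma radial_le_tangent:
  assumes nn: "\<And>k. k \<in> {1..p-1} \<Longrightarrow> 0 \<le> \<Lambda> k" and "0 \<le> y" and "y \<le> x"
  shows "radial p \<Lambda> x \<le> radial p \<Lambda> y + (1 - lip_const p \<Lambda> y) * (x - y)"
proof -
  have "\<Lambda> k * y ^ (k + 1) + (real k + 1) * \<Lambda> k * y ^ k * (x - y) \<le> \<Lambda> k * x ^ (k + 1)"
    if "k \<in> {1..p-1}" for k
    using mult_left_mono[OF power_Suc_ge_tangent[OF assms(2,3), of k] nn[OF that]]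
    by (simp add: algebra_simps)
  then have "(\<Sum>k=1..p-1. \<Lambda> k * y ^ (k + 1)) + lip_const p \<Lambda> y * (x - y)
      \<le> (\<Sum>k=1..p-1. \<Lambda> k * x ^ (k + 1))"
    unfolding lip_const_def sum_distrib_right sum.distrib[symmetric] by (intro sum_mono)
  then show ?thesis
    by (simp add: radial_def algebra_simps)
qed

section \<open>Lipschitz perturbations of the identity\<close>

text \<open>A discrete product rule: changing one of the \<open>k + 1\<close> factors at a time
  costs at most \<open>L * r ^ k * cmod (z - w)\<close> each, because \<open>f 0 = 0\<close> gives
  \<open>cmod (f w) \<le> L * r\<close>.\<close>

lemma cnj_power_mult_lipschitz:
  assumes "f 0 = 0" and lip: "\<And>z w. z \<in> S \<Longrightarrow> w \<in> S \<Longrightarrow> cmod (f z - f w) \<le> L * cmod (z - w)"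
    and S: "0 \<in> S" "z \<in> S" "w \<in> S" and r: "cmod z \<le> r" "cmod w \<le> r" and "0 \<le> L"
  shows "cmod (cnj z ^ k * f z - cnj w ^ k * f w) \<le> (real k + 1) * L * r ^ k * cmod (z - w)"
proof (induction k)
  case 0
  then show ?case using lip S by simp
next
  case (Suc k)
  have r0: "0 \<le> r"
    using r(1) norm_ge_zero order_trans by blast
  let ?u = "\<lambda>z. cnj z ^ k * f z"
  have "cmod (f w) \<le> L * r"
    using lip[OF S(3,1)] \<open>f 0 = 0\<close> mult_left_mono[OF r(2) \<open>0 \<le> L\<close>] by simp
  then have uw: "cmod (?u w) \<le> r ^ k * (L * r)"
    unfolding norm_mult norm_power complex_mod_cnj using r r0
    by (intro mult_mono power_mono) auto
  have "cnj z ^ Suc k * f z - cnj w ^ Suc k * f w = cnj z * (?u z - ?u w) + cnj (z - w) * ?u w"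
    by (simp add: algebra_simps)
  then have "cmod (cnj z ^ Suc k * f z - cnj w ^ Suc k * f w)
      \<le> cmod z * cmod (?u z - ?u w) + cmod (z - w) * cmod (?u w)"
    by (metis complex_mod_cnj norm_mult norm_triangle_ineq)
  also have "\<dots> \<le> r * ((real k + 1) * L * r ^ k * cmod (z - w)) + cmod (z - w) * (r ^ k * (L * r))"
    using Suc uw r r0 by (intro add_mono mult_mono) auto
  also have "\<dots> = (real (Suc k) + 1) * L * r ^ Suc k * cmod (z - w)"
    by (simp add: algebra_simps)
  finally show ?case .
qed

text \<open>The set \<open>S\<close> is a parameter because the unit disk suits admissible
  functions, whereas the extremal function is also studied at the boundary point
  \<open>rho2\<close>, which may lie on the unit circle.\<close>

locale lipschitz_perturbation =
  fixes p :: nat and \<Lambda> :: "nat \<Rightarrow> real" and A :: "nat \<Rightarrow> complex \<Rightarrow> complex" and S :: "complex set"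
  assumes nn: "\<And>k. k \<in> {1..p-1} \<Longrightarrow> 0 \<le> \<Lambda> k"
    and A0: "\<And>k. k \<in> {1..p-1} \<Longrightarrow> A k 0 = 0"
    and lip: "\<And>k z w. k \<in> {1..p-1} \<Longrightarrow> z \<in> S \<Longrightarrow> w \<in> S \<Longrightarrow>
      cmod (A k z - A k w) \<le> \<Lambda> k * cmod (z - w)"
    and S: "ball 0 1 \<subseteq> S"
begin

lemma S0: "0 \<in> S"
  using S by auto

lemma perturb_lipschitz:
  assumes "z \<in> S" "w \<in> S" "cmod z \<le> r" "cmod w \<le> r"
  shows "cmod (perturb p A z - perturb p A w) \<le> lip_const p \<Lambda> r * cmod (z - w)"
  unfolding perturb_def lip_const_def sum_distrib_right sum_subtractf[symmetric]
  using assms A0 lip nn S0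
  by (intro order_trans[OF norm_sum] sum_mono cnj_power_mult_lipschitz[where S = S]) auto

text \<open>Here \<open>r - radial p \<Lambda> r\<close> is the sum of the
  \<open>\<Lambda> k * r ^ (k + 1)\<close>. The bound makes the fixed point map below preserve a
  closed disk.\<close>

lemma perturb_bound:
  assumes z: "z \<in> S" "cmod z \<le> r"
  shows "cmod (perturb p A z) \<le> r - radial p \<Lambda> r"
proof -
  have "cmod (cnj z ^ k * A k z) \<le> \<Lambda> k * r ^ (k + 1)" if k: "k \<in> {1..p-1}" for k
  proof -
    have "cmod (A k z) \<le> \<Lambda> k * r"
      using lip[OF k z(1) S0] A0[OF k] mult_left_mono[OF z(2) nn[OF k]] by simp
    moreover have "cmod z ^ k \<le> r ^ k"
      using z(2) by (intro power_mono) auto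
    moreover have "0 \<le> r"
      using z(2) norm_ge_zero order_trans by blast
    ultimately have "cmod z ^ k * cmod (A k z) \<le> r ^ k * (\<Lambda> k * r)"
      by (intro mult_mono) auto
    then show ?thesis
      by (simp add: norm_mult norm_power algebra_simps)
  qed
  then show ?thesis
    unfolding perturb_def radial_def diff_diff_eq2 add_diff_cancel_left' by (rule sum_norm_le)
qed

text \<open>The constant depends on the larger modulus: \<open>lip_const\<close> may tend to 1 at
  \<open>rho2\<close>, so this bound need not yield a uniform constant on the open disk.\<close>

lemma perturb_strict_contraction:
  assumes "z \<in> S" "w \<in> S" "cmod z < rho2 p \<Lambda>" "cmod w < rho2 p \<Lambda>" "z \<noteq> w"
  shows "cmod (perturb p A z - perturb p A w) < cmod (z - w)"
proof -
  let ?r = "max (cmod z) (cmod w)"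
  have "lip_const p \<Lambda> ?r < 1"
    using assms rho2_bounds[of p \<Lambda>, OF nn] nn by (intro lip_const_less[of p \<Lambda> _ "rho2 p \<Lambda>"]) (auto simp: le_max_iff_disj)
  then have "lip_const p \<Lambda> ?r * cmod (z - w) < 1 * cmod (z - w)"
    using assms by (intro mult_strict_right_mono) auto
  then show ?thesis
    using perturb_lipschitz[OF assms(1,2) max.cobounded1 max.cobounded2] by simp
qed

lemma ball_rho2_subset: "ball 0 (rho2 p \<Lambda>) \<subseteq> S"
  using S rho2_bounds(2)[of p \<Lambda>, OF nn] by auto

lemma inj_on_id_plus_perturb: "inj_on (\<lambda>z. z + perturb p A z) (ball 0 (rho2 p \<Lambda>))"
proof (rule inj_onI, rule ccontr)
  fix z w assume zw: "z \<in> ball 0 (rho2 p \<Lambda>)" "w \<in> ball 0 (rho2 p \<Lambda>)"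
    and eq: "z + perturb p A z = w + perturb p A w" and ne: "z \<noteq> w"
  have "cmod (perturb p A z - perturb p A w) = cmod (z - w)"
  proof -
    have "perturb p A z - perturb p A w = - (z - w)"
      using eq by (simp add: algebra_simps)
    then show ?thesis
      by (simp only: norm_minus_cancel)
  qed
  moreover have "cmod (perturb p A z - perturb p A w) < cmod (z - w)"
    using zw ne ball_rho2_subset by (intro perturb_strict_contraction) auto
  ultimately show False by simp
qed

lemma continuous_on_id_plus_perturb:
  "continuous_on (ball 0 (rho2 p \<Lambda>)) (\<lambda>z. z + perturb p A z)"
proof -
  have "continuous_on S (A k)" if "k \<in> {1..p-1}" for k
    using lip[OF that] nn[OF that]
    by (intro lipschitz_on_continuous_on[of "\<Lambda> k"] lipschitz_onI) (auto simp: dist_norm)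
  then have "continuous_on S (\<lambda>z. z + perturb p A z)"
    unfolding perturb_def by (intro continuous_intros) auto
  then show ?thesis
    using ball_rho2_subset by (rule continuous_on_subset)
qed

lemma ball_sigma2_subset_image:
  "ball 0 (sigma2 p \<Lambda>) \<subseteq> (\<lambda>z::complex. z + perturb p A z) ` ball 0 (rho2 p \<Lambda>)"
proof
  fix w :: complex assume "w \<in> ball 0 (sigma2 p \<Lambda>)"
  then have w: "cmod w < radial p \<Lambda> (rho2 p \<Lambda>)"
    by (simp add: sigma2_eq)
  note \<rho> = rho2_bounds[of p \<Lambda>, OF nn]
  have "continuous_on {0..rho2 p \<Lambda>} (radial p \<Lambda>)"
    unfolding radial_def by (intro continuous_intros)
  \<comment> \<open>With this radius, \<open>cmod w + (r - radial p \<Lambda> r) = r\<close>, so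
    \<open>z \<mapsto> w - perturb p A z\<close> maps \<open>cball 0 r\<close> into itself.\<close>
  then obtain r where r: "0 \<le> r" "r \<le> rho2 p \<Lambda>" "radial p \<Lambda> r = cmod w"
    using IVT'[of "radial p \<Lambda>" 0 "cmod w" "rho2 p \<Lambda>"] w \<rho>(1) by (auto simp: radial_def)
  then have r\<rho>: "r < rho2 p \<Lambda>"
    using w by (cases "r = rho2 p \<Lambda>") auto
  have sub: "cball 0 r \<subseteq> S"
    using r\<rho> ball_rho2_subset by auto
  have "\<exists>!z\<in>cball 0 r. w - perturb p A z = z"
  proof (rule Banach_fix)
    show "complete (cball (0::complex) r)" "cball (0::complex) r \<noteq> {}"
      using r by (auto intro: compact_imp_complete)
    show "0 \<le> lip_const p \<Lambda> r"
      using nn r by (intro lip_const_nonneg)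
    show "lip_const p \<Lambda> r < 1"
      using nn r r\<rho> \<rho> by (intro lip_const_less[of p \<Lambda> _ "rho2 p \<Lambda>"])
    show "(\<lambda>z. w - perturb p A z) ` cball 0 r \<subseteq> cball 0 r"
    proof clarsimp
      fix z assume "cmod z \<le> r"
      then have "cmod (perturb p A z) \<le> r - cmod w"
        using perturb_bound[of z r] sub r by auto
      then show "cmod (w - perturb p A z) \<le> r"
        using norm_triangle_ineq4[of w "perturb p A z"] by simp
    qed
    show "dist (w - perturb p A x) (w - perturb p A y) \<le> lip_const p \<Lambda> r * dist x y"
      if "x \<in> cball 0 r" "y \<in> cball 0 r" for x y
      using perturb_lipschitz[of y x r] that subsetD[OF sub] by (simp add: dist_norm norm_minus_commute)
  qed
  then obtain z where "z \<in> cball 0 r" "w = z + perturb p A z"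
    by (metis diff_add_cancel)
  then show "w \<in> (\<lambda>z. z + perturb p A z) ` ball 0 (rho2 p \<Lambda>)"
    using r\<rho> by auto
qed

end

text \<open>The region is the preimage of the disk. It is connected as the image of the disk under
  the inverse of \<open>F\<close>, which is continuous by invariance of domain.\<close>

lemma schlicht_disk_inI:
  assumes cont: "continuous_on (ball 0 \<rho>) F" and inj: "inj_on F (ball 0 \<rho>)"
    and sub: "ball c R \<subseteq> F ` ball 0 \<rho>" and R: "0 < R"
  shows "schlicht_disk_in F \<rho> (ball c R)"
proof -
  obtain g where g: "homeomorphism (ball 0 \<rho>) (F ` ball 0 \<rho>) F g"
    using invariance_of_domain_homeomorphism[OF open_ball cont _ inj] by auto
  define D where "D = ball 0 \<rho> \<inter> F -` ball c R"
  have img: "F ` D = ball c R"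
    using sub by (auto simp: D_def)
  have "g ` F ` D = D"
    using g by (force simp: D_def homeomorphism_def image_iff)
  then have "D = g ` ball c R"
    by (simp add: img)
  moreover have "continuous_on (ball c R) g"
    by (rule continuous_on_subset[OF homeomorphism_cont2[OF g] sub])
  ultimately have "connected D"
    by (simp add: connected_continuous_image)
  moreover have "open D"
    unfolding D_def using cont by (intro continuous_open_preimage) auto
  moreover have "D \<noteq> {}"
    using img centre_in_ball[of c R] R by blast
  moreover have "inj_on F D" "D \<subseteq> ball 0 \<rho>"
    using inj by (auto simp: D_def intro: inj_on_subset)
  ultimately show ?thesis
    unfolding schlicht_disk_in_def using img R by blast
qed

section \<open>Admissible functions\<close>

lemma deriv_bound_imp_lipschitz:
  assumes "f analytic_on ball 0 1" and "\<And>z. z \<in> ball 0 1 \<Longrightarrow> cmod (deriv f z) \<le> L"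
    and "z \<in> ball 0 1" and "w \<in> ball 0 1"
  shows "cmod (f z - f w) \<le> L * cmod (z - w)"
proof (rule field_differentiable_bound[of "ball 0 1" f "deriv f"])
  show "(f has_field_derivative deriv f x) (at x within ball 0 1)" if "x \<in> ball 0 1" for x
    using analytic_imp_holomorphic[OF assms(1)] that
    by (auto intro: holomorphic_derivI)
qed (use assms in auto)

lemma normalized_Schwarz_eq_id:
  assumes an: "f analytic_on ball 0 1" and f0: "f 0 = 0" and df: "deriv f 0 = 1"
    and bd: "(\<forall>z\<in>ball 0 1. cmod (f z) < 1) \<or> (\<forall>z\<in>ball 0 1. cmod (deriv f z) \<le> 1)"
    and z: "z \<in> ball 0 1"
  shows "f z = z"
proof -
  have hol: "f holomorphic_on ball 0 1"
    using an by (rule analytic_imp_holomorphic)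
  \<comment> \<open>In the derivative case, the mean value inequality with constant 1 gives
    \<open>cmod (f w) \<le> cmod w\<close>.\<close>
  have lt: "cmod (f w) < 1" if "cmod w < 1" for w
    using bd
  proof
    assume "\<forall>z\<in>ball 0 1. cmod (deriv f z) \<le> 1"
    then show ?thesis
      using deriv_bound_imp_lipschitz[OF an, of 1 w 0] that f0 by auto
  qed (use that in auto)
  \<comment> \<open>The normalization \<open>deriv f 0 = 1\<close> is the equality case of Schwarz's
    lemma.\<close>
  obtain \<alpha> where \<alpha>: "\<And>w. cmod w < 1 \<Longrightarrow> f w = \<alpha> * w"
    using Schwarz_Lemma(3)[OF hol f0 lt, of 0] df by auto
  have "deriv f 0 = deriv (\<lambda>w. \<alpha> * w) 0"
  proof (rule deriv_cong_ev[OF _ refl])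
    show "\<forall>\<^sub>F w in nhds 0. f w = \<alpha> * w"
      using \<alpha> eventually_nhds_in_open[of "ball 0 1" "0::complex"] by (auto elim: eventually_mono)
  qed
  then have "\<alpha> = 1"
    using df by simp
  then show ?thesis
    using \<alpha>[of z] z by simp
qed

lemma admissible_eq:
  assumes p: "0 < p" and adm: "admissible p \<Lambda> A F" and z: "z \<in> ball 0 1"
  shows "F z = z + perturb p A z"
proof -
  have "A 0 z = z"
    using adm by (intro normalized_Schwarz_eq_id[OF _ _ _ _ z]) (simp_all add: admissible_def)
  moreover have "F z = (\<Sum>k=0..p-1. cnj z ^ k * A k z)"
    using adm z by (simp add: admissible_def)
  ultimately show ?thesis
    by (simp add: perturb_def sum.atLeast_Suc_atMost)
qed

lemma admissible_imp_lipschitz_perturbation: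
  assumes "\<And>k. k \<in> {1..p-1} \<Longrightarrow> 0 \<le> \<Lambda> k" and adm: "admissible p \<Lambda> A F"
  shows "lipschitz_perturbation p \<Lambda> A (ball 0 1)"
proof
  show "cmod (A k z - A k w) \<le> \<Lambda> k * cmod (z - w)"
    if "k \<in> {1..p-1}" "z \<in> ball 0 1" "w \<in> ball 0 1" for k z w
    using adm that unfolding admissible_def by (intro deriv_bound_imp_lipschitz) auto
qed (use assms in \<open>auto simp: admissible_def\<close>)

lemma admissible_univalent_and_covering:
  assumes p: "0 < p" and nn: "\<And>k. k \<in> {1..p-1} \<Longrightarrow> 0 \<le> \<Lambda> k" and adm: "admissible p \<Lambda> A F"
  shows "inj_on F (ball 0 (rho2 p \<Lambda>))"
    and "schlicht_disk_in F (rho2 p \<Lambda>) (ball 0 (sigma2 p \<Lambda>))"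
proof -
  interpret lipschitz_perturbation p \<Lambda> A "ball 0 1"
    using nn adm by (rule admissible_imp_lipschitz_perturbation)
  have eq: "F z = z + perturb p A z" if "z \<in> ball 0 (rho2 p \<Lambda>)" for z
    using ball_rho2_subset that by (intro admissible_eq[OF p adm]) auto
  show inj: "inj_on F (ball 0 (rho2 p \<Lambda>))"
    using inj_on_id_plus_perturb by (subst inj_on_cong[OF eq])
  have "continuous_on (ball 0 (rho2 p \<Lambda>)) F"
    using continuous_on_id_plus_perturb by (subst continuous_on_cong[OF refl eq])
  moreover have "ball 0 (sigma2 p \<Lambda>) \<subseteq> F ` ball 0 (rho2 p \<Lambda>)"
    using ball_sigma2_subset_image by (subst image_cong[OF refl eq])
  ultimately show "schlicht_disk_in F (rho2 p \<Lambda>) (ball 0 (sigma2 p \<Lambda>))"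
    using inj sigma2_pos[OF nn] by (intro schlicht_disk_inI)
qed

section \<open>Polynomials in the conjugate variable\<close>

lemma has_derivative_mult_poly_cnj:
  "((\<lambda>z. z * poly P (cnj z)) has_derivative
     (\<lambda>h. h * poly P (cnj z) + z * (poly (pderiv P) (cnj z) * cnj h))) (at z)"
proof -
  have "((\<lambda>z. poly P (cnj z)) has_derivative (\<lambda>h. poly (pderiv P) (cnj z) * cnj h)) (at z)"
    by (rule has_derivative_compose[OF has_derivative_cnj[OF has_derivative_ident]
          poly_DERIV[unfolded has_field_derivative_def]])
  then show ?thesis
    by (auto intro!: derivative_eq_intros simp: algebra_simps)
qed

text \<open>In directions 1 and \<i>, the factor \<open>h\<close> contributes
  \<open>1 + \<i> * \<i> = 0\<close> and the factor \<open>cnj h\<close> contributes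
  \<open>1 + \<i> * cnj \<i> = 2\<close>. Thus \<open>deriv_cnj\<close> acts as
  \<open>pderiv\<close> on \<open>P\<close>.\<close>

lemma deriv_cnj_mult_poly_cnj:
  "deriv_cnj (\<lambda>z. z * poly P (cnj z)) = (\<lambda>z. z * poly (pderiv P) (cnj z))"
  unfolding deriv_cnj_def fun_eq_iff
    frechet_derivative_at[OF has_derivative_mult_poly_cnj, symmetric]
  by (simp add: algebra_simps)

lemma funpow_deriv_cnj_mult_poly_cnj:
  "(deriv_cnj ^^ j) (\<lambda>z. z * poly P (cnj z)) = (\<lambda>z. z * poly ((pderiv ^^ j) P) (cnj z))"
  by (induction j) (simp_all add: deriv_cnj_mult_poly_cnj)

lemma funpow_pderiv_eq_0:
  fixes P :: "'a :: {comm_semiring_1,semiring_no_zero_divisors,semiring_char_0} poly"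
  assumes "degree P < n"
  shows "(pderiv ^^ n) P = 0"
  using assms
proof (induction n arbitrary: P)
  case (Suc n)
  show ?case
  proof (cases "n = 0")
    case True
    then show ?thesis
      using Suc.prems by (simp add: pderiv_eq_0_iff)
  next
    case False
    then have "(pderiv ^^ n) (pderiv P) = 0"
      using Suc.prems by (intro Suc.IH) (simp add: degree_pderiv)
    then show ?thesis
      by (simp add: funpow_swap1)
  qed
qed simp

text \<open>Iterating \<open>deriv_cnj\<close> stays within this family of functions, and
  \<open>p\<close> formal derivatives annihilate a polynomial of degree below
  \<open>p\<close>.\<close>

lemma polyanalytic_on_mult_poly_cnj:
  assumes "degree P < p" and "open D" "connected D" "D \<noteq> {}"
  shows "polyanalytic_on p (\<lambda>z. z * poly P (cnj z)) D"
  unfolding polyanalytic_on_def funpow_deriv_cnj_mult_poly_cnj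
proof (intro conjI allI ballI impI)
  show "continuous_on D (\<lambda>z. z * poly P (cnj z))"
    by (intro continuous_intros)
  show "(\<lambda>z. z * poly ((pderiv ^^ j) P) (cnj z)) differentiable at z" for j z
    using has_derivative_mult_poly_cnj unfolding differentiable_def by blast
qed (use assms in \<open>simp_all add: funpow_pderiv_eq_0\<close>)

section \<open>The extremal function\<close>

definition F2_coeff :: "(nat \<Rightarrow> real) \<Rightarrow> nat \<Rightarrow> complex \<Rightarrow> complex" where
  "F2_coeff \<Lambda> k z = (if k = 0 then z else - of_real (\<Lambda> k) * z)"

lemma F2_eq: "F2 p \<Lambda> z = z + perturb p (F2_coeff \<Lambda>) z"
proof -
  have "perturb p (F2_coeff \<Lambda>) z = - (\<Sum>k=1..p-1. of_real (\<Lambda> k) * cnj z ^ k * z)"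
    unfolding perturb_def sum_negf[symmetric] by (intro sum.cong) (auto simp: F2_coeff_def)
  then show ?thesis
    by (simp add: F2_def)
qed

text \<open>This reduces the failure of univalence to a question about one real variable.\<close>

lemma F2_of_real: "F2 p \<Lambda> (of_real x) = of_real (radial p \<Lambda> x)"
  by (simp add: F2_def radial_def mult.assoc power_commutes)

lemma polyanalytic_on_F2:
  assumes "0 < p"
  shows "polyanalytic_on p (F2 p \<Lambda>) (ball 0 1)"
proof -
  \<comment> \<open>Factoring out \<open>z\<close> leaves a polynomial in \<open>cnj z\<close>
    alone.\<close>
  define P where "P = 1 - (\<Sum>k=1..p-1. monom (complex_of_real (\<Lambda> k)) k)"
  have "degree (monom (complex_of_real (\<Lambda> k)) k) \<le> p - 1" if "k \<in> {1..p-1}" for k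
    by (rule order_trans[OF degree_monom_le]) (use that in auto)
  then have "degree P \<le> p - 1"
    unfolding P_def by (intro degree_diff_le degree_sum_le) auto
  then have "degree P < p"
    using assms by simp
  moreover have "F2 p \<Lambda> = (\<lambda>z. z * poly P (cnj z))"
    by (auto simp: F2_def P_def poly_sum poly_monom sum_distrib_left algebra_simps)
  ultimately show ?thesis
    using polyanalytic_on_mult_poly_cnj[of P p "ball 0 1"] by simp
qed

lemma deriv_F2_coeff: "deriv (F2_coeff \<Lambda> k) z = (if k = 0 then 1 else - of_real (\<Lambda> k))"
  unfolding F2_coeff_def by (auto intro!: DERIV_imp_deriv derivative_eq_intros)

lemma admissible_F2:
  assumes p: "0 < p" and nn: "\<And>k. k \<in> {1..p-1} \<Longrightarrow> 0 \<le> \<Lambda> k"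
  shows "admissible p \<Lambda> (F2_coeff \<Lambda>) (F2 p \<Lambda>)"
proof -
  have "F2 p \<Lambda> z = (\<Sum>k=0..p-1. cnj z ^ k * F2_coeff \<Lambda> k z)" for z
    by (simp add: F2_eq perturb_def sum.atLeast_Suc_atMost F2_coeff_def)
  moreover have "F2_coeff \<Lambda> k analytic_on ball 0 1" for k
    unfolding F2_coeff_def by (cases "k = 0") (auto intro!: analytic_intros)
  ultimately show ?thesis
    unfolding admissible_def deriv_F2_coeff using polyanalytic_on_F2[OF p] nn
    by (auto simp: F2_coeff_def)
qed

lemma lipschitz_perturbation_F2_coeff:
  assumes "\<And>k. k \<in> {1..p-1} \<Longrightarrow> 0 \<le> \<Lambda> k"
  shows "lipschitz_perturbation p \<Lambda> (F2_coeff \<Lambda>) UNIV"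
proof
  show "cmod (F2_coeff \<Lambda> k z - F2_coeff \<Lambda> k w) \<le> \<Lambda> k * cmod (z - w)" if "k \<in> {1..p-1}" for k z w
  proof -
    have "F2_coeff \<Lambda> k z - F2_coeff \<Lambda> k w = - of_real (\<Lambda> k) * (z - w)"
      using that by (simp add: F2_coeff_def algebra_simps)
    then show ?thesis
      using assms[OF that] by (simp only: norm_mult norm_minus_cancel norm_of_real)
  qed
qed (use assms in \<open>auto simp: F2_coeff_def\<close>)

section \<open>Sharpness of \<open>rho2\<close> and \<open>sigma2\<close>\<close>

text \<open>A continuous injective real function on an interval is strictly monotone, but
  \<open>radial\<close> increases from 0 to \<open>rho2\<close> and is no larger beyond.\<close>

lemma not_inj_on_F2:
  assumes nn: "\<And>k. k \<in> {1..p-1} \<Longrightarrow> 0 \<le> \<Lambda> k" and r: "rho2 p \<Lambda> < r" "r \<le> 1"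
  shows "\<not> inj_on (F2 p \<Lambda>) (ball 0 r)"
proof
  assume inj: "inj_on (F2 p \<Lambda>) (ball 0 r)"
  let ?\<rho> = "rho2 p \<Lambda>"
  \<comment> \<open>The bounds on \<open>r\<close> exclude \<open>rho2 p \<Lambda> = 1\<close>,
    leaving the case of a root.\<close>
  have \<rho>: "0 < ?\<rho>" "lip_const p \<Lambda> ?\<rho> = 1"
    by (rule rho2_cases[of p \<Lambda>, OF nn]; use r in simp)+
  obtain x where x: "?\<rho> < x" "x < r"
    using r(1) dense by blast
  have "radial p \<Lambda> 0 < radial p \<Lambda> ?\<rho> \<and> radial p \<Lambda> ?\<rho> < radial p \<Lambda> x \<or>
      radial p \<Lambda> x < radial p \<Lambda> ?\<rho> \<and> radial p \<Lambda> ?\<rho> < radial p \<Lambda> 0"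
  proof (rule continuous_inj_imp_mono[of 0 ?\<rho> x])
    show "continuous_on {0..x} (radial p \<Lambda>)"
      unfolding radial_def by (intro continuous_intros)
    show "inj_on (radial p \<Lambda>) {0..x}"
    proof (rule inj_onI)
      fix s t assume st: "s \<in> {0..x}" "t \<in> {0..x}" "radial p \<Lambda> s = radial p \<Lambda> t"
      have "F2 p \<Lambda> (of_real s) = F2 p \<Lambda> (of_real t)"
        using st(3) by (simp only: F2_of_real)
      then have "complex_of_real s = of_real t"
        by (rule inj_onD[OF inj]) (use st(1,2) x in auto)
      then show "s = t" by simp
    qed
  qed (use \<rho> x in auto)
  moreover have "radial p \<Lambda> x \<le> radial p \<Lambda> ?\<rho>"
    using radial_le_tangent[of p \<Lambda> ?\<rho> x] nn \<rho> x by simp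
  moreover have "radial p \<Lambda> 0 = 0" "0 < radial p \<Lambda> ?\<rho>"
    using sigma2_pos[of p \<Lambda>, OF nn] by (simp_all add: sigma2_eq, simp add: radial_def)
  ultimately show False by linarith
qed

lemma sigma2_notin_image_F2:
  assumes nn: "\<And>k. k \<in> {1..p-1} \<Longrightarrow> 0 \<le> \<Lambda> k"
  shows "of_real (sigma2 p \<Lambda>) \<notin> F2 p \<Lambda> ` ball 0 (rho2 p \<Lambda>)"
proof
  assume "of_real (sigma2 p \<Lambda>) \<in> F2 p \<Lambda> ` ball 0 (rho2 p \<Lambda>)"
  then obtain z where z: "cmod z < rho2 p \<Lambda>" and eq: "F2 p \<Lambda> z = of_real (sigma2 p \<Lambda>)"
    by (metis imageE mem_ball_0)
  interpret lipschitz_perturbation p \<Lambda> "F2_coeff \<Lambda>" UNIV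
    using nn by (rule lipschitz_perturbation_F2_coeff)
  let ?G = "perturb p (F2_coeff \<Lambda>)"
  note \<rho> = rho2_bounds[of p \<Lambda>, OF nn]
  define b where "b = complex_of_real (rho2 p \<Lambda>)"
  \<comment> \<open>Strict contraction needs both points in the open disk, so it applies to
    \<open>z\<close> and \<open>m\<close> but not to \<open>z\<close> and \<open>b\<close>; from
    \<open>m\<close> to \<open>b\<close> the constant is only at most 1.\<close>
  define m where "m = midpoint z b"
  have b: "cmod b = rho2 p \<Lambda>"
    using \<rho>(1) by (simp add: b_def)
  then have "z \<noteq> b"
    using z by auto
  have mz: "cmod (z - m) = cmod (z - b) / 2" and mb: "cmod (m - b) = cmod (z - b) / 2"
    by (simp_all add: m_def dist_midpoint flip: dist_norm)
  have "cmod m < rho2 p \<Lambda>"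
    using norm_triangle_ineq[of z b] z b by (simp add: m_def midpoint_def)
  moreover have "z \<noteq> m"
    using \<open>z \<noteq> b\<close> mz by auto
  ultimately have "cmod (?G z - ?G m) < cmod (z - m)"
    using z by (intro perturb_strict_contraction) auto
  moreover have "cmod (?G m - ?G b) \<le> cmod (m - b)"
  proof -
    have "cmod (?G m - ?G b) \<le> lip_const p \<Lambda> (rho2 p \<Lambda>) * cmod (m - b)"
      using \<open>cmod m < rho2 p \<Lambda>\<close> b by (intro perturb_lipschitz) auto
    also have "\<dots> \<le> 1 * cmod (m - b)"
      using \<rho>(3) by (intro mult_right_mono) auto
    finally show ?thesis by simp
  qed
  moreover have "cmod (?G z - ?G b) = cmod (z - b)"
  proof -
    have "F2 p \<Lambda> z = F2 p \<Lambda> b"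
      by (simp add: eq b_def F2_of_real sigma2_eq)
    then have "?G z - ?G b = - (z - b)"
      by (simp add: F2_eq algebra_simps)
    then show ?thesis
      by (simp only: norm_minus_cancel)
  qed
  ultimately show False
    using norm_triangle_ineq[of "?G z - ?G m" "?G m - ?G b"] mz mb by simp
qed

theorem theorem2:
  fixes p :: nat and \<Lambda> :: "nat \<Rightarrow> real"
  assumes "0 < p"
    and "\<And>k. k \<in> {1..p-1} \<Longrightarrow> 0 \<le> \<Lambda> k"
  shows "((\<Sum>k=1..p-1. (real k + 1) * \<Lambda> k) > 1 \<longrightarrow> (\<exists>!r. is_radius_root p \<Lambda> r)) \<and>
    (\<forall>A F. admissible p \<Lambda> A F \<longrightarrow>
       inj_on F (ball 0 (rho2 p \<Lambda>)) \<and>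
       schlicht_disk_in F (rho2 p \<Lambda>) (ball 0 (sigma2 p \<Lambda>))) \<and>
    (\<exists>A. admissible p \<Lambda> A (F2 p \<Lambda>)) \<and>
    (\<forall>r. rho2 p \<Lambda> < r \<and> r \<le> 1 \<longrightarrow> \<not> inj_on (F2 p \<Lambda>) (ball 0 r)) \<and>
    (\<forall>R. sigma2 p \<Lambda> < R \<longrightarrow> \<not> ball 0 R \<subseteq> F2 p \<Lambda> ` ball 0 (rho2 p \<Lambda>))"
proof (intro conjI allI impI)
  show "\<exists>!r. is_radius_root p \<Lambda> r" if "(\<Sum>k=1..p-1. (real k + 1) * \<Lambda> k) > 1"
    using ex1_radius_root[of p \<Lambda>] assms(2) that by (simp add: lip_const_one)
next
  fix A F assume "admissible p \<Lambda> A F"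
  with assms show "inj_on F (ball 0 (rho2 p \<Lambda>))"
    and "schlicht_disk_in F (rho2 p \<Lambda>) (ball 0 (sigma2 p \<Lambda>))"
    by (intro admissible_univalent_and_covering[of p \<Lambda> A]; simp)+
next
  show "\<exists>A. admissible p \<Lambda> A (F2 p \<Lambda>)"
    using admissible_F2[of p \<Lambda>] assms by blast
next
  show "\<not> inj_on (F2 p \<Lambda>) (ball 0 r)" if "rho2 p \<Lambda> < r \<and> r \<le> 1" for r
    using not_inj_on_F2[of p \<Lambda> r] assms(2) that by simp
next
  fix R assume "sigma2 p \<Lambda> < R"
  \<comment> \<open>Positivity is needed because the modulus of this point is the absolute value of
    \<open>sigma2\<close>.\<close>
  then have "complex_of_real (sigma2 p \<Lambda>) \<in> ball 0 R"
    using sigma2_pos[of p \<Lambda>, OF assms(2)] by simp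
  then show "\<not> ball 0 R \<subseteq> F2 p \<Lambda> ` ball 0 (rho2 p \<Lambda>)"
    using sigma2_notin_image_F2[of p \<Lambda>, OF assms(2)] by blast
qed

end
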